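(* Let $\lambda=(\gamma_0,c_0)\in C_2$ have elliptic coordinates $(\varphi,k)$, let $s_2=\mathrm{sgn}(c_0)$, and put $\psi=\frac{\varphi}{k}$, $\psi_t=\psi+\frac{t}{k}$, $k'^2=1-k^2$ and $w=\dfrac{1}{\mathrm{dn}\,\psi-k\,\mathrm{cn}\,\psi}$. Then the extremal trajectory $q_t=(x_t,y_t,z_t)$ with initial covector $\lambda$ and $q_0=(0,0,0)$ is given, for all $t\ge0$, by $$x_t=\frac12\left(\frac{1}{w(1-k^2)}-w\right)\left[\mathrm{E}(\psi_t)-\mathrm{E}(\psi)-k'^2(\psi_t-\psi)\right]+\frac12\left(kw+\frac{k}{w(1-k^2)}\right)\left[\mathrm{sn}\,\psi_t-\mathrm{sn}\,\psi\right],$$ $$y_t=-\frac{s_2}{2}\left(\frac{1}{w(1-k^2)}+w\right)\left[\mathrm{E}(\psi_t)-\mathrm{E}(\psi)-k'^2(\psi_t-\psi)\right]+\frac{s_2}{2}\left(kw-\frac{k}{w(1-k^2)}\right)\left[\mathrm{sn}\,\psi_t-\mathrm{sn}\,\psi\right],$$ $$z_t=s_2\ln\left[(\mathrm{dn}\,\psi_t-k\,\mathrm{cn}\,\psi_t)\,w\right].$$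
   Context: Setting: $M=\mathrm{SH}(2)$ is the Lie group of matrices $\begin{pmatrix}\cosh z&\sinh z&x\\ \sinh z&\cosh z&y\\0&0&1\end{pmatrix}$, identified with $\mathbb{R}^3$ via $(x,y,z)$ (identity $=(0,0,0)$), with the left-invariant sub-Riemannian structure having orthonormal frame $f_1=\cosh z\,\partial_x+\sinh z\,\partial_y$, $f_2=\partial_z$. Its arc-length parametrized normal extremals starting at the identity, given by the Pontryagin Maximum Principle, are described as follows. The phase cylinder is $C=(\mathbb{R}/4\pi\mathbb{Z})\times\mathbb{R}\ni(\gamma,c)$. For $\lambda=(\gamma_0,c_0)\in C$, let $(\gamma_t,c_t,x_t,y_t,z_t)$ solve $$\dot\gamma=c,\quad \dot c=-\sin\gamma,\quad \dot x=\cos\tfrac{\gamma}{2}\cosh z,\quad \dot y=\cos\tfrac{\gamma}{2}\sinh z,\quad \dot z=\sin\tfrac{\gamma}{2},$$ with initial values $(\gamma_0,c_0)$ and $x_0=y_0=z_0=0$. The curve $q_t=(x_t,y_t,z_t)$ is the extremal trajectory with initial covector $\lambda$. The pendulum energy is $E=\frac{c^2}{2}-\cos\gamma$, and $C_2=\{(\gamma,c)\in C: E\in(1,\infty)\}$. Elliptic coordinates $(\varphi,k)$ on $C_2$: $k=\sqrt{\frac{2}{E+1}}=\left(\sin^2\frac{\gamma}{2}+\frac{c^2}{4}\right)^{-1/2}\in(0,1)$, and $\varphi$ (defined modulo $4kK(k)$) is determined by $\sin\frac{\gamma}{2}=s_2\,\mathrm{sn}(\frac{\varphi}{k},k)$,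 $\cos\frac{\gamma}{2}=\mathrm{cn}(\frac{\varphi}{k},k)$, $\frac{c}{2}=\frac{s_2}{k}\mathrm{dn}(\frac{\varphi}{k},k)$, where $s_2=\mathrm{sgn}(c)$. Here $\mathrm{sn},\mathrm{cn},\mathrm{dn}$ are the Jacobi elliptic functions with modulus $k$ (so $\mathrm{sn}\,\psi=\mathrm{sn}(\psi,k)$, and $\mathrm{dn}^2=1-k^2\mathrm{sn}^2$), $K(k)$ is the complete elliptic integral of the first kind, and $\mathrm{E}(\psi)=\mathrm{E}(\psi,k)=\int_0^{\psi}\mathrm{dn}^2(t,k)\,dt$. *)

theory Defs
  imports "HOL-Analysis.Analysis"
begin

text \<open>
  Jacobi elliptic functions of modulus \<open>k \<in> [0, 1)\<close>. The amplitude is the inverse of the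
  incomplete elliptic integral of the first kind, which for such \<open>k\<close> is an increasing bijection
  of the reals; the interval integrals are signed, so negative arguments are covered.
\<close>

definition ell_F :: "real \<Rightarrow> real \<Rightarrow> real" where
  "ell_F u k = (LBINT \<theta>=0..u. 1 / sqrt (1 - k\<^sup>2 * (sin \<theta>)\<^sup>2))"

definition jacobi_am :: "real \<Rightarrow> real \<Rightarrow> real" where
  "jacobi_am \<psi> k = (THE u. ell_F u k = \<psi>)"

definition jacobi_sn :: "real \<Rightarrow> real \<Rightarrow> real" where
  "jacobi_sn \<psi> k = sin (jacobi_am \<psi> k)"

definition jacobi_cn :: "real \<Rightarrow> real \<Rightarrow> real" where
  "jacobi_cn \<psi> k = cos (jacobi_am \<psi> k)"

definition jacobi_dn :: "real \<Rightarrow> real \<Rightarrow> real" where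
  "jacobi_dn \<psi> k = sqrt (1 - k\<^sup>2 * (jacobi_sn \<psi> k)\<^sup>2)"

text \<open>Here \<open>\<psi>\<close> is the argument of the Jacobi functions, not the amplitude.\<close>

definition jacobi_E :: "real \<Rightarrow> real \<Rightarrow> real" where
  "jacobi_E \<psi> k = (LBINT t=0..\<psi>. (jacobi_dn t k)\<^sup>2)"

text \<open>
  A point of the phase cylinder \<open>C = (\<real>/4\<pi>\<int>) \<times> \<real>\<close> is given by any real representative of its
  angle \<open>\<gamma>\<close>: everything below depends on \<open>\<gamma>\<close> only through functions of period \<open>4\<pi>\<close>, and
  a curve in \<open>C\<close> lifts uniquely once a representative of its initial angle is chosen.
\<close>

definition pendulum_energy :: "real \<times> real \<Rightarrow> real" where
  "pendulum_energy = (\<lambda>(\<gamma>, c). c\<^sup>2 / 2 - cos \<gamma>)"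

definition C2 :: "(real \<times> real) set" where
  "C2 = {p. pendulum_energy p \<in> {1<..}}"

text \<open>
  Elliptic coordinates \<open>(\<phi>, k)\<close> on \<open>C2\<close>. The relation is satisfied by every real representative
  \<open>\<phi>\<close> of the coordinate, which is determined only modulo \<open>4 k K(k)\<close>.
\<close>

definition elliptic_coordinates :: "real \<times> real \<Rightarrow> real \<Rightarrow> real \<Rightarrow> bool" where
  "elliptic_coordinates = (\<lambda>(\<gamma>, c) \<phi> k.
     k = sqrt (2 / (pendulum_energy (\<gamma>, c) + 1)) \<and>
     sin (\<gamma> / 2) = sgn c * jacobi_sn (\<phi> / k) k \<and>
     cos (\<gamma> / 2) = jacobi_cn (\<phi> / k) k \<and>
     c / 2 = sgn c / k * jacobi_dn (\<phi> / k) k)"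

text \<open>
  Extremal trajectories on \<open>SH(2)\<close>, in the coordinates \<open>(x, y, z)\<close> that identify the group with
  \<open>\<real>\<^sup>3\<close>: the first two equations are the vertical part of the Hamiltonian system, the other three
  say \<open>q' = cos (\<gamma>/2) f\<^sub>1(q) + sin (\<gamma>/2) f\<^sub>2(q)\<close> for the left-invariant orthonormal frame
  \<open>f\<^sub>1 = cosh z \<partial>\<^sub>x + sinh z \<partial>\<^sub>y\<close>, \<open>f\<^sub>2 = \<partial>\<^sub>z\<close>. At \<open>t = 0\<close> the derivatives are one-sided.
\<close>

definition extremal_trajectory :: "real \<times> real \<Rightarrow> (real \<Rightarrow> real \<times> real \<times> real) \<Rightarrow> bool" where
  "extremal_trajectory = (\<lambda>(\<gamma>\<^sub>0, c\<^sub>0) q. \<exists>\<gamma> c x y z.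
     q = (\<lambda>t. (x t, y t, z t)) \<and>
     \<gamma> 0 = \<gamma>\<^sub>0 \<and> c 0 = c\<^sub>0 \<and> x 0 = 0 \<and> y 0 = 0 \<and> z 0 = 0 \<and>
     (\<forall>t\<ge>0.
        (\<gamma> has_real_derivative c t) (at t within {0..}) \<and>
        (c has_real_derivative - sin (\<gamma> t)) (at t within {0..}) \<and>
        (x has_real_derivative cos (\<gamma> t / 2) * cosh (z t)) (at t within {0..}) \<and>
        (y has_real_derivative cos (\<gamma> t / 2) * sinh (z t)) (at t within {0..}) \<and>
        (z has_real_derivative sin (\<gamma> t / 2)) (at t within {0..})))"

end

theory Submission
  imports Defs
begin

text \<open>
  The pendulum is solved first. Its energy is conserved and exceeds \<open>1\<close> on \<^const>\<open>C2\<close>, so the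
  momentum \<open>c\<close> keeps its sign and equals \<open>(2 s\<^sub>2/k) sqrt (1 - k\<^sup>2 sin\<^sup>2(\<gamma>/2))\<close>
  (\<open>rotating_pendulum_momentum\<close>). This is a separable first-order equation for \<open>\<gamma>/2\<close>; the
  substitution by the elliptic integral \<^const>\<open>ell_F\<close> turns it into motion at constant speed
  \<open>1/k\<close>, that is, \<open>sin(\<gamma>\<^sub>t/2) = s\<^sub>2 sn \<psi>\<^sub>t\<close> and \<open>cos(\<gamma>\<^sub>t/2) = cn \<psi>\<^sub>t\<close>
  (\<open>rotating_pendulum_elliptic_coordinates\<close>). This argument integrates the given solution itself,
  instead of exhibiting a solution and comparing the two.

  The rest is three successive quadratures. The equation \<open>z' = s\<^sub>2 sn \<psi>\<^sub>t\<close> is solved by the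
  logarithm of \<open>dn - k cn\<close>, whose logarithmic derivative is \<open>k sn\<close>. Hence \<open>exp (s\<^sub>2 z)\<close> is
  \<open>w (dn - k cn)\<close>, and its inverse is \<open>(dn + k cn) / (w (1 - k\<^sup>2))\<close> because
  \<open>(dn - k cn)(dn + k cn) = 1 - k\<^sup>2\<close> (\<open>jacobi_dn_cn_product\<close>). So \<open>x' = cn cosh z\<close> and
  \<open>y' = cn sinh z\<close> are linear combinations of \<open>cn dn\<close> and \<open>k cn\<^sup>2\<close>, with the primitives
  \<open>k sn\<close> and \<open>E - (1 - k\<^sup>2) \<psi>\<^sub>t\<close> (\<open>primitive_cn_dn\<close>, \<open>primitive_k_cn_squared\<close>).
\<close>

section \<open>Jacobi elliptic functions\<close>

lemma interval_integral_has_real_derivative: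
  fixes f :: "real \<Rightarrow> real"
  assumes "continuous_on UNIV f"
  shows "((\<lambda>u. LBINT t=0..u. f t) has_real_derivative f u) (at u)"
proof -
  (* any interval with both 0 and u in its interior, so that the derivative at u is two-sided *)
  define a b where "a = min 0 u - 1" and "b = max 0 u + 1"
  have "continuous_on {a..b} f"
    by (rule continuous_on_subset[OF assms]) simp
  then have "((\<lambda>u. LBINT t=0..u. f t) has_vector_derivative f u) (at u within {a..b})"
    using interval_integral_FTC2[of a 0 b f u] by (simp add: a_def b_def zero_ereal_def)
  moreover have "at u within {a..b} = at u"
    by (rule at_within_interior) (auto simp: a_def b_def)
  ultimately show ?thesis
    by (simp add: has_real_derivative_iff_has_vector_derivative)
qed

lemma elliptic_radicand_pos:
  fixes k u :: real
  assumes "k\<^sup>2 < 1"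
  shows "0 < 1 - k\<^sup>2 * (sin u)\<^sup>2"
proof -
  have "k\<^sup>2 * (sin u)\<^sup>2 \<le> k\<^sup>2 * 1"
    by (intro mult_left_mono) (auto simp: abs_square_le_1)
  with assms show ?thesis by simp
qed

lemma ell_F_has_real_derivative:
  assumes "k\<^sup>2 < 1"
  shows "((\<lambda>u. ell_F u k) has_real_derivative 1 / sqrt (1 - k\<^sup>2 * (sin u)\<^sup>2)) (at u)"
proof -
  have "continuous_on UNIV (\<lambda>\<theta>::real. 1 / sqrt (1 - k\<^sup>2 * (sin \<theta>)\<^sup>2))"
    by (intro continuous_intros) (use elliptic_radicand_pos[OF assms] in \<open>auto simp: less_le\<close>)
  then show ?thesis
    unfolding ell_F_def by (rule interval_integral_has_real_derivative)
qed

lemma ell_F_strict_mono: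
  assumes "k\<^sup>2 < 1"
  shows "strict_mono (\<lambda>u. ell_F u k)"
proof (rule strict_monoI)
  fix u v :: real
  assume "u < v"
  then show "ell_F u k < ell_F v k"
  proof (rule DERIV_pos_imp_increasing)
    fix x
    show "\<exists>D. ((\<lambda>u. ell_F u k) has_real_derivative D) (at x) \<and> 0 < D"
      using ell_F_has_real_derivative[OF assms] elliptic_radicand_pos[OF assms]
      by (intro exI conjI) auto
  qed
qed

text \<open>
  The integrand of \<^const>\<open>ell_F\<close> is at least \<open>1\<close>, so the integral dominates the identity on both
  sides of the origin, and the intermediate value theorem applies.
\<close>

lemma ell_F_surj:
  assumes "k\<^sup>2 < 1"
  shows "\<exists>u. ell_F u k = \<psi>"
proof -
  have zero: "ell_F 0 k = 0"
    by (simp add: ell_F_def zero_ereal_def)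
  have incr: "ell_F u k - u \<le> ell_F v k - v" if "u \<le> v" for u v
  proof (rule DERIV_nonneg_imp_nondecreasing[OF that])
    fix x :: real
    have "sqrt (1 - k\<^sup>2 * (sin x)\<^sup>2) \<le> 1" by simp
    then have "1 \<le> 1 / sqrt (1 - k\<^sup>2 * (sin x)\<^sup>2)"
      using elliptic_radicand_pos[OF assms, of x] by simp
    moreover have "((\<lambda>u. ell_F u k - u) has_real_derivative
        1 / sqrt (1 - k\<^sup>2 * (sin x)\<^sup>2) - 1) (at x)"
      by (intro derivative_intros ell_F_has_real_derivative assms)
    ultimately show "\<exists>D. ((\<lambda>u. ell_F u k - u) has_real_derivative D) (at x) \<and> 0 \<le> D"
      by (intro exI conjI) auto
  qed
  have "ell_F (min 0 \<psi>) k \<le> \<psi>"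
    using incr[of "min 0 \<psi>" 0] by (auto simp: min_def zero split: if_splits)
  moreover have "\<psi> \<le> ell_F (max 0 \<psi>) k"
    using incr[of 0 "max 0 \<psi>"] by (auto simp: max_def zero split: if_splits)
  moreover have "isCont (\<lambda>u. ell_F u k) x" for x
    using ell_F_has_real_derivative[OF assms] by (rule DERIV_isCont)
  ultimately show ?thesis
    using IVT[of "\<lambda>u. ell_F u k" "min 0 \<psi>" \<psi> "max 0 \<psi>"]
    by (auto simp: min_le_iff_disj le_max_iff_disj)
qed

lemma jacobi_am_ell_F:
  assumes "k\<^sup>2 < 1"
  shows "jacobi_am (ell_F u k) k = u"
  unfolding jacobi_am_def
  using strict_mono_eq[OF ell_F_strict_mono[OF assms]] by (intro the_equality) auto

lemma ell_F_jacobi_am: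
  assumes "k\<^sup>2 < 1"
  shows "ell_F (jacobi_am \<psi> k) k = \<psi>"
  using ell_F_surj[OF assms, of \<psi>] jacobi_am_ell_F[OF assms] by auto

lemma jacobi_dn_pos:
  assumes "k\<^sup>2 < 1"
  shows "0 < jacobi_dn \<psi> k"
  using elliptic_radicand_pos[OF assms] by (simp add: jacobi_dn_def jacobi_sn_def)

lemma jacobi_dn_squared:
  assumes "k\<^sup>2 < 1"
  shows "(jacobi_dn \<psi> k)\<^sup>2 = 1 - k\<^sup>2 * (jacobi_sn \<psi> k)\<^sup>2"
  using elliptic_radicand_pos[OF assms, of "jacobi_am \<psi> k"]
  by (simp add: jacobi_dn_def jacobi_sn_def)

lemma jacobi_sn_cn_squared: "(jacobi_sn \<psi> k)\<^sup>2 + (jacobi_cn \<psi> k)\<^sup>2 = 1"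
  by (simp add: jacobi_sn_def jacobi_cn_def)

lemma jacobi_am_has_real_derivative:
  assumes "k\<^sup>2 < 1"
  shows "((\<lambda>\<psi>. jacobi_am \<psi> k) has_real_derivative jacobi_dn \<psi> k) (at \<psi>)"
proof -
  let ?u = "jacobi_am \<psi> k"
  have "isCont (\<lambda>\<psi>. jacobi_am \<psi> k) (ell_F ?u k)"
    by (rule isCont_inverse_function[where d = 1])
       (auto simp: jacobi_am_ell_F[OF assms]
             intro: DERIV_isCont[OF ell_F_has_real_derivative[OF assms]])
  then have cont: "isCont (\<lambda>\<psi>. jacobi_am \<psi> k) \<psi>"
    by (simp add: ell_F_jacobi_am[OF assms])
  have "((\<lambda>\<psi>. jacobi_am \<psi> k) has_real_derivative
      inverse (1 / sqrt (1 - k\<^sup>2 * (sin ?u)\<^sup>2))) (at \<psi>)"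
    by (rule DERIV_inverse_function[OF ell_F_has_real_derivative[OF assms],
          where a = "\<psi> - 1" and b = "\<psi> + 1"])
       (use cont elliptic_radicand_pos[OF assms, of ?u] in \<open>auto simp: ell_F_jacobi_am[OF assms]\<close>)
  then show ?thesis
    by (simp add: jacobi_dn_def jacobi_sn_def)
qed

lemma jacobi_sn_has_real_derivative:
  assumes "k\<^sup>2 < 1"
  shows "((\<lambda>\<psi>. jacobi_sn \<psi> k) has_real_derivative jacobi_cn \<psi> k * jacobi_dn \<psi> k) (at \<psi>)"
  unfolding jacobi_sn_def jacobi_cn_def
  by (rule DERIV_fun_sin[OF jacobi_am_has_real_derivative[OF assms]])

lemma jacobi_cn_has_real_derivative:
  assumes "k\<^sup>2 < 1"
  shows "((\<lambda>\<psi>. jacobi_cn \<psi> k) has_real_derivative - jacobi_sn \<psi> k * jacobi_dn \<psi> k) (at \<psi>)"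
  unfolding jacobi_sn_def jacobi_cn_def
  by (rule DERIV_fun_cos[OF jacobi_am_has_real_derivative[OF assms]])

lemma jacobi_dn_has_real_derivative:
  assumes "k\<^sup>2 < 1"
  shows "((\<lambda>\<psi>. jacobi_dn \<psi> k) has_real_derivative - k\<^sup>2 * jacobi_sn \<psi> k * jacobi_cn \<psi> k) (at \<psi>)"
proof -
  have "0 < 1 - k\<^sup>2 * (jacobi_sn \<psi> k)\<^sup>2"
    using elliptic_radicand_pos[OF assms] by (simp add: jacobi_sn_def)
  then have "((\<lambda>\<psi>. sqrt (1 - k\<^sup>2 * (jacobi_sn \<psi> k)\<^sup>2)) has_real_derivative
      - k\<^sup>2 * jacobi_sn \<psi> k * jacobi_cn \<psi> k * jacobi_dn \<psi> k / sqrt (1 - k\<^sup>2 * (jacobi_sn \<psi> k)\<^sup>2))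
      (at \<psi>)"
    by (auto intro!: derivative_eq_intros jacobi_sn_has_real_derivative[OF assms]
             simp: field_simps)
  then show ?thesis
    using jacobi_dn_pos[OF assms, of \<psi>] by (simp add: jacobi_dn_def mult.assoc)
qed

lemma jacobi_E_has_real_derivative:
  assumes "k\<^sup>2 < 1"
  shows "((\<lambda>\<psi>. jacobi_E \<psi> k) has_real_derivative (jacobi_dn \<psi> k)\<^sup>2) (at \<psi>)"
proof -
  have "continuous_on UNIV (\<lambda>t. jacobi_dn t k)"
    by (rule DERIV_continuous_on[OF jacobi_dn_has_real_derivative[OF assms]])
  then have "continuous_on UNIV (\<lambda>t. (jacobi_dn t k)\<^sup>2)"
    by (intro continuous_intros)
  then show ?thesis
    unfolding jacobi_E_def by (rule interval_integral_has_real_derivative)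
qed

text \<open>
  Conjugate factors of \<open>dn\<^sup>2 - k\<^sup>2 cn\<^sup>2\<close>, which is constant. The consequences used below are that
  \<open>dn - k cn\<close> never vanishes, so its logarithm exists, and that its inverse is a multiple of
  \<open>dn + k cn\<close>.
\<close>

lemma jacobi_dn_cn_product:
  assumes "k\<^sup>2 < 1"
  shows "(jacobi_dn \<psi> k - k * jacobi_cn \<psi> k) * (jacobi_dn \<psi> k + k * jacobi_cn \<psi> k) = 1 - k\<^sup>2"
proof -
  have "(jacobi_cn \<psi> k)\<^sup>2 = 1 - (jacobi_sn \<psi> k)\<^sup>2"
    using jacobi_sn_cn_squared[of \<psi> k] by simp
  then have "(jacobi_dn \<psi> k)\<^sup>2 - k\<^sup>2 * (jacobi_cn \<psi> k)\<^sup>2 = 1 - k\<^sup>2"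
    unfolding jacobi_dn_squared[OF assms] by (simp add: right_diff_distrib)
  then show ?thesis
    by (simp add: algebra_simps power2_eq_square)
qed

lemma jacobi_dn_minus_cn_pos:
  assumes "k\<^sup>2 < 1"
  shows "0 < jacobi_dn \<psi> k - k * jacobi_cn \<psi> k"
proof (rule ccontr)
  let ?D = "jacobi_dn \<psi> k" and ?C = "k * jacobi_cn \<psi> k"
  assume "\<not> 0 < ?D - ?C"
  then have "?D - ?C \<le> 0" and "0 \<le> ?D + ?C"
    using jacobi_dn_pos[OF assms, of \<psi>] by linarith+
  then have "(?D - ?C) * (?D + ?C) \<le> 0"
    by (rule mult_nonpos_nonneg)
  with jacobi_dn_cn_product[OF assms, of \<psi>] assms show False by simp
qed

lemma ln_jacobi_dn_minus_cn_has_real_derivative: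
  assumes "k\<^sup>2 < 1"
  shows "((\<lambda>\<psi>. ln (jacobi_dn \<psi> k - k * jacobi_cn \<psi> k)) has_real_derivative k * jacobi_sn \<psi> k) (at \<psi>)"
proof -
  let ?A = "jacobi_dn \<psi> k - k * jacobi_cn \<psi> k"
  have "((\<lambda>\<psi>. ln (jacobi_dn \<psi> k - k * jacobi_cn \<psi> k)) has_real_derivative
      (- k\<^sup>2 * jacobi_sn \<psi> k * jacobi_cn \<psi> k - k * (- jacobi_sn \<psi> k * jacobi_dn \<psi> k)) / ?A) (at \<psi>)"
    using jacobi_dn_minus_cn_pos[OF assms]
    by (auto intro!: derivative_eq_intros jacobi_dn_has_real_derivative[OF assms]
          jacobi_cn_has_real_derivative[OF assms])
  moreover have "- k\<^sup>2 * jacobi_sn \<psi> k * jacobi_cn \<psi> k - k * (- jacobi_sn \<psi> k * jacobi_dn \<psi> k)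
      = k * jacobi_sn \<psi> k * ?A"
    by (simp add: algebra_simps power2_eq_square)
  ultimately show ?thesis
    using jacobi_dn_minus_cn_pos[OF assms, of \<psi>] by simp
qed

section \<open>The pendulum in elliptic coordinates\<close>

lemma equal_if_equal_derivatives_nonneg:
  fixes f g :: "real \<Rightarrow> real"
  assumes "\<And>t. t \<ge> 0 \<Longrightarrow> (f has_real_derivative D t) (at t within {0..})"
    and "\<And>t. t \<ge> 0 \<Longrightarrow> (g has_real_derivative D t) (at t within {0..})"
    and "f 0 = g 0" and "t \<ge> 0"
  shows "f t = g t"
proof -
  have "((\<lambda>t. f t - g t) has_real_derivative 0) (at t within {0..})" if "t \<ge> 0" for t
    using DERIV_diff[OF assms(1,2)[OF that]] by simp
  then obtain d where "\<And>t. t \<ge> 0 \<Longrightarrow> f t - g t = d"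
    using has_field_derivative_zero_constant[of "{0..}" "\<lambda>t. f t - g t"] by auto
  from this[of 0] this[of t] assms(3,4) show ?thesis by simp
qed

lemma C2_modulus:
  assumes "(\<gamma>, c) \<in> C2" and "k = sqrt (2 / (pendulum_energy (\<gamma>, c) + 1))"
  shows "0 < k" and "k\<^sup>2 < 1" and "c \<noteq> 0" and "pendulum_energy (\<gamma>, c) = 2 / k\<^sup>2 - 1"
proof -
  let ?e = "pendulum_energy (\<gamma>, c)"
  have e: "?e > 1" using assms(1) by (simp add: C2_def)
  have k2: "k\<^sup>2 = 2 / (?e + 1)" using e by (simp add: assms(2))
  show "0 < k" using e by (simp add: assms(2))
  show "k\<^sup>2 < 1" using e by (simp add: k2)
  show "?e = 2 / k\<^sup>2 - 1" using e by (simp add: k2 field_simps)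
  show "c \<noteq> 0"
  proof
    assume "c = 0"
    with e have "cos \<gamma> < -1" by (simp add: pendulum_energy_def)
    with cos_ge_minus_one[of \<gamma>] show False by linarith
  qed
qed

lemma pendulum_energy_conserved:
  assumes \<gamma>: "\<And>t. t \<ge> 0 \<Longrightarrow> (\<gamma> has_real_derivative c t) (at t within {0..})"
    and c: "\<And>t. t \<ge> 0 \<Longrightarrow> (c has_real_derivative - sin (\<gamma> t)) (at t within {0..})"
    and "t \<ge> 0"
  shows "pendulum_energy (\<gamma> t, c t) = pendulum_energy (\<gamma> 0, c 0)"
proof (rule equal_if_equal_derivatives_nonneg[where f = "\<lambda>t. pendulum_energy (\<gamma> t, c t)"
      and D = "\<lambda>_. 0", OF _ _ _ \<open>t \<ge> 0\<close>])
  fix t :: real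
  assume t: "t \<ge> 0"
  show "((\<lambda>t. pendulum_energy (\<gamma> t, c t)) has_real_derivative 0) (at t within {0..})"
    unfolding pendulum_energy_def prod.case
    by (auto intro!: derivative_eq_intros \<gamma>[OF t] c[OF t])
qed auto

text \<open>
  Above the separatrix energy \<open>1\<close> the momentum cannot vanish, so by continuity it keeps its sign
  and conservation of energy can be solved for it.
\<close>

lemma rotating_pendulum_momentum:
  assumes \<gamma>: "\<And>t. t \<ge> 0 \<Longrightarrow> (\<gamma> has_real_derivative c t) (at t within {0..})"
    and c: "\<And>t. t \<ge> 0 \<Longrightarrow> (c has_real_derivative - sin (\<gamma> t)) (at t within {0..})"
    and C2: "(\<gamma> 0, c 0) \<in> C2"
    and k: "k = sqrt (2 / (pendulum_energy (\<gamma> 0, c 0) + 1))"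
    and "t \<ge> 0"
  shows "c t / 2 = sgn (c 0) / k * sqrt (1 - k\<^sup>2 * (sin (\<gamma> t / 2))\<^sup>2)"
proof -
  note k_facts = C2_modulus[OF C2 k]
  have energy: "pendulum_energy (\<gamma> t, c t) = pendulum_energy (\<gamma> 0, c 0)" if "t \<ge> 0" for t
    by (rule pendulum_energy_conserved[OF \<gamma> c that])
  have nz: "c t \<noteq> 0" if "t \<ge> 0" for t
    using C2 energy[OF that] C2_modulus(3)[of "\<gamma> t" "c t"] by (simp add: C2_def)
  have "connected (c ` {0..})"
    by (intro connected_continuous_image DERIV_continuous_on[where D = "\<lambda>t. - sin (\<gamma> t)"])
       (auto intro: c)
  moreover have "c t \<in> c ` {0..}" "c 0 \<in> c ` {0..}" "0 \<notin> c ` {0..}"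
    using nz \<open>t \<ge> 0\<close> by force+
  ultimately have "\<not> (c t \<le> 0 \<and> 0 \<le> c 0)" "\<not> (c 0 \<le> 0 \<and> 0 \<le> c t)"
    unfolding connected_iff_interval by blast+
  then have sgn: "sgn (c t) = sgn (c 0)"
    by (auto simp: sgn_if)
  have "(c t)\<^sup>2 / 2 - cos (2 * (\<gamma> t / 2)) = 2 / k\<^sup>2 - 1"
    using energy[OF \<open>t \<ge> 0\<close>] k_facts(4) by (simp add: pendulum_energy_def)
  then have "(c t / 2)\<^sup>2 = 1 / k\<^sup>2 - (sin (\<gamma> t / 2))\<^sup>2"
    unfolding cos_double_sin by (simp add: power_divide)
  also have "\<dots> = (1 - k\<^sup>2 * (sin (\<gamma> t / 2))\<^sup>2) / k\<^sup>2"
    using k_facts(1) by (simp add: field_simps)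
  finally have "\<bar>c t / 2\<bar> = sqrt (1 - k\<^sup>2 * (sin (\<gamma> t / 2))\<^sup>2) / k"
    using k_facts(1) by (metis real_sqrt_abs real_sqrt_divide abs_of_pos)
  moreover have "c t / 2 = sgn (c 0) * \<bar>c t / 2\<bar>"
    unfolding sgn[symmetric] by (simp add: sgn_if)
  ultimately show ?thesis by simp
qed

text \<open>
  Elliptic coordinates straighten the pendulum flow: by the formula for the momentum,
  \<^const>\<open>ell_F\<close> of \<open>s \<gamma>/2\<close> grows at the constant rate \<open>1/k\<close>, where \<open>s\<close> is the sign of \<open>c\<close>.
  At time \<open>0\<close> the angle \<open>s \<gamma>/2\<close> is only known to agree with the amplitude modulo \<open>2\<pi>\<close>, which is
  why the amplitude at time \<open>0\<close> is continued by the increment of \<open>s \<gamma>/2\<close> instead of comparing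
  both directly.
\<close>

lemma rotating_pendulum_elliptic_coordinates:
  assumes \<gamma>: "\<And>t. t \<ge> 0 \<Longrightarrow> (\<gamma> has_real_derivative c t) (at t within {0..})"
    and c: "\<And>t. t \<ge> 0 \<Longrightarrow> (c has_real_derivative - sin (\<gamma> t)) (at t within {0..})"
    and C2: "(\<gamma> 0, c 0) \<in> C2"
    and ell: "elliptic_coordinates (\<gamma> 0, c 0) \<phi> k"
    and "t \<ge> 0"
  shows "sin (\<gamma> t / 2) = sgn (c 0) * jacobi_sn (\<phi> / k + t / k) k"
    and "cos (\<gamma> t / 2) = jacobi_cn (\<phi> / k + t / k) k"
proof -
  define s where "s = sgn (c 0)"
  have k: "k = sqrt (2 / (pendulum_energy (\<gamma> 0, c 0) + 1))"
    and sin0: "sin (\<gamma> 0 / 2) = s * jacobi_sn (\<phi> / k) k"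
    and cos0: "cos (\<gamma> 0 / 2) = jacobi_cn (\<phi> / k) k"
    using ell by (auto simp: elliptic_coordinates_def s_def)
  note k_facts = C2_modulus[OF C2 k]
  have s: "s = 1 \<or> s = -1"
    using k_facts(3) by (auto simp: s_def sgn_if)
  define u where "u t = jacobi_am (\<phi> / k) k + s * (\<gamma> t / 2 - \<gamma> 0 / 2)" for t
  have am: "sin (jacobi_am (\<phi> / k) k) = sin (s * (\<gamma> 0 / 2))"
           "cos (jacobi_am (\<phi> / k) k) = cos (s * (\<gamma> 0 / 2))"
    using sin0 cos0 s by (auto simp: jacobi_sn_def jacobi_cn_def)
  have "sin (u t) = sin (s * (\<gamma> 0 / 2) + s * (\<gamma> t / 2 - \<gamma> 0 / 2))"
       "cos (u t) = cos (s * (\<gamma> 0 / 2) + s * (\<gamma> t / 2 - \<gamma> 0 / 2))" for t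
    by (simp_all only: u_def sin_add cos_add am)
  then have u: "sin (u t) = s * sin (\<gamma> t / 2)" "cos (u t) = cos (\<gamma> t / 2)" for t
    using s by (auto simp: algebra_simps)
  have "ell_F (u t) k = \<phi> / k + t / k"
  proof (rule equal_if_equal_derivatives_nonneg[where f = "\<lambda>t. ell_F (u t) k"
        and D = "\<lambda>_. 1 / k", OF _ _ _ \<open>t \<ge> 0\<close>])
    fix t :: real
    assume t: "t \<ge> 0"
    define R where "R = sqrt (1 - k\<^sup>2 * (sin (u t))\<^sup>2)"
    have R: "R > 0"
      using elliptic_radicand_pos[OF k_facts(2)] by (simp add: R_def)
    have "(sin (u t))\<^sup>2 = (sin (\<gamma> t / 2))\<^sup>2"
      using s by (auto simp: u)
    then have mom: "c t / 2 = s / k * R"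
      using rotating_pendulum_momentum[OF \<gamma> c C2 k t] by (simp add: s_def R_def)
    have "(u has_real_derivative s * (c t / 2)) (at t within {0..})"
      unfolding u_def by (auto intro!: derivative_eq_intros \<gamma>[OF t])
    from DERIV_chain2[OF ell_F_has_real_derivative[OF k_facts(2)] this]
    have "((\<lambda>t. ell_F (u t) k) has_real_derivative 1 / R * (s * (c t / 2))) (at t within {0..})"
      by (simp add: R_def)
    moreover have "1 / R * (s * (c t / 2)) = 1 / k"
      unfolding mom using s R by auto
    ultimately show "((\<lambda>t. ell_F (u t) k) has_real_derivative 1 / k) (at t within {0..})"
      by simp
    show "((\<lambda>t. \<phi> / k + t / k) has_real_derivative 1 / k) (at t within {0..})"
      using k_facts(1) by (auto intro!: derivative_eq_intros)
  next
    show "ell_F (u 0) k = \<phi> / k + 0 / k"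
      by (simp add: u_def ell_F_jacobi_am[OF k_facts(2)])
  qed
  then have "jacobi_am (\<phi> / k + t / k) k = u t"
    using jacobi_am_ell_F[OF k_facts(2), of "u t"] by simp
  then show "sin (\<gamma> t / 2) = sgn (c 0) * jacobi_sn (\<phi> / k + t / k) k"
    and "cos (\<gamma> t / 2) = jacobi_cn (\<phi> / k + t / k) k"
    using s by (auto simp: jacobi_sn_def jacobi_cn_def u s_def[symmetric])
qed

section \<open>The extremal trajectories\<close>

text \<open>
  The bracket in the formulas for \<open>x\<close> and \<open>y\<close> is a primitive of \<open>k cn\<^sup>2\<close> along the flow, because
  \<open>dn\<^sup>2 - (1 - k\<^sup>2) = k\<^sup>2 cn\<^sup>2\<close>.
\<close>

lemma primitive_k_cn_squared:
  assumes "k\<^sup>2 < 1" and "k \<noteq> 0"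
  shows "((\<lambda>t. jacobi_E (\<psi> + t / k) k - jacobi_E \<psi> k - (1 - k\<^sup>2) * (\<psi> + t / k - \<psi>))
    has_real_derivative k * (jacobi_cn (\<psi> + t / k) k)\<^sup>2) (at t within S)"
proof -
  let ?p = "\<psi> + t / k"
  have arg: "((\<lambda>t. \<psi> + t / k) has_real_derivative 1 / k) (at t within S)"
    using assms by (auto intro!: derivative_eq_intros)
  have cn: "(jacobi_cn ?p k)\<^sup>2 = 1 - (jacobi_sn ?p k)\<^sup>2"
    using jacobi_sn_cn_squared[of ?p k] by simp
  have "(jacobi_dn ?p k)\<^sup>2 * (1 / k) - (1 - k\<^sup>2) * (1 / k) = k * (jacobi_cn ?p k)\<^sup>2"
    unfolding jacobi_dn_squared[OF assms(1)] cn
    using assms(2) by (simp add: field_simps power2_eq_square)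
  moreover have "((\<lambda>t. jacobi_E (\<psi> + t / k) k - jacobi_E \<psi> k - (1 - k\<^sup>2) * (\<psi> + t / k - \<psi>))
    has_real_derivative (jacobi_dn ?p k)\<^sup>2 * (1 / k) - 0 - (1 - k\<^sup>2) * (1 / k - 0)) (at t within S)"
    by (intro DERIV_diff DERIV_cmult DERIV_const arg
        DERIV_chain2[OF jacobi_E_has_real_derivative[OF assms(1)] arg])
  ultimately show ?thesis by simp
qed

lemma primitive_cn_dn:
  assumes "k\<^sup>2 < 1" and "k \<noteq> 0"
  shows "((\<lambda>t. k * (jacobi_sn (\<psi> + t / k) k - jacobi_sn \<psi> k))
    has_real_derivative jacobi_cn (\<psi> + t / k) k * jacobi_dn (\<psi> + t / k) k) (at t within S)"
proof -
  have arg: "((\<lambda>t. \<psi> + t / k) has_real_derivative 1 / k) (at t within S)"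
    using assms by (auto intro!: derivative_eq_intros)
  have "((\<lambda>t. k * (jacobi_sn (\<psi> + t / k) k - jacobi_sn \<psi> k)) has_real_derivative
      k * (jacobi_cn (\<psi> + t / k) k * jacobi_dn (\<psi> + t / k) k * (1 / k) - 0)) (at t within S)"
    by (intro DERIV_diff DERIV_cmult DERIV_const
        DERIV_chain2[OF jacobi_sn_has_real_derivative[OF assms(1)] arg])
  then show ?thesis using assms(2) by simp
qed

theorem theorem5p2:
  fixes \<gamma>\<^sub>0 c\<^sub>0 \<phi> k k' s\<^sub>2 \<psi> w :: real and \<psi>\<^sub>t x y z :: "real \<Rightarrow> real"
  assumes "(\<gamma>\<^sub>0, c\<^sub>0) \<in> C2"
    and "elliptic_coordinates (\<gamma>\<^sub>0, c\<^sub>0) \<phi> k"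
    and "s\<^sub>2 = sgn c\<^sub>0"
    and "\<psi> = \<phi> / k"
    and "\<And>t. \<psi>\<^sub>t t = \<psi> + t / k"
    and "k'\<^sup>2 = 1 - k\<^sup>2"
    and "w = 1 / (jacobi_dn \<psi> k - k * jacobi_cn \<psi> k)"
    and "extremal_trajectory (\<gamma>\<^sub>0, c\<^sub>0) (\<lambda>t. (x t, y t, z t))"
  shows "\<forall>t\<ge>0.
    x t = 1 / 2 * (1 / (w * (1 - k\<^sup>2)) - w)
            * (jacobi_E (\<psi>\<^sub>t t) k - jacobi_E \<psi> k - k'\<^sup>2 * (\<psi>\<^sub>t t - \<psi>))
          + 1 / 2 * (k * w + k / (w * (1 - k\<^sup>2))) * (jacobi_sn (\<psi>\<^sub>t t) k - jacobi_sn \<psi> k) \<and>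
    y t = - (s\<^sub>2 / 2) * (1 / (w * (1 - k\<^sup>2)) + w)
            * (jacobi_E (\<psi>\<^sub>t t) k - jacobi_E \<psi> k - k'\<^sup>2 * (\<psi>\<^sub>t t - \<psi>))
          + s\<^sub>2 / 2 * (k * w - k / (w * (1 - k\<^sup>2))) * (jacobi_sn (\<psi>\<^sub>t t) k - jacobi_sn \<psi> k) \<and>
    z t = s\<^sub>2 * ln ((jacobi_dn (\<psi>\<^sub>t t) k - k * jacobi_cn (\<psi>\<^sub>t t) k) * w)"
proof -
  obtain \<gamma> c where init: "\<gamma> 0 = \<gamma>\<^sub>0" "c 0 = c\<^sub>0" "x 0 = 0" "y 0 = 0" "z 0 = 0"
    and ode: "\<And>t. t \<ge> 0 \<Longrightarrow> (\<gamma> has_real_derivative c t) (at t within {0..})"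
      "\<And>t. t \<ge> 0 \<Longrightarrow> (c has_real_derivative - sin (\<gamma> t)) (at t within {0..})"
      "\<And>t. t \<ge> 0 \<Longrightarrow> (x has_real_derivative cos (\<gamma> t / 2) * cosh (z t)) (at t within {0..})"
      "\<And>t. t \<ge> 0 \<Longrightarrow> (y has_real_derivative cos (\<gamma> t / 2) * sinh (z t)) (at t within {0..})"
      "\<And>t. t \<ge> 0 \<Longrightarrow> (z has_real_derivative sin (\<gamma> t / 2)) (at t within {0..})"
    using assms(8) unfolding extremal_trajectory_def prod.case fun_eq_iff prod.inject
    by (metis (no_types, lifting) ext)
  have "k = sqrt (2 / (pendulum_energy (\<gamma>\<^sub>0, c\<^sub>0) + 1))"
    using assms(2) by (simp add: elliptic_coordinates_def)
  note k_facts = C2_modulus[OF assms(1) this]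
  note k = k_facts(2) and k_pos = k_facts(1)
  have s: "s\<^sub>2 = 1 \<or> s\<^sub>2 = -1"
    using k_facts(3) by (auto simp: assms(3) sgn_if)
  have \<psi>\<^sub>t: "\<psi>\<^sub>t t = \<psi> + t / k" for t by (rule assms(5))
  have sin_\<gamma>: "sin (\<gamma> t / 2) = s\<^sub>2 * jacobi_sn (\<psi>\<^sub>t t) k"
    and cos_\<gamma>: "cos (\<gamma> t / 2) = jacobi_cn (\<psi>\<^sub>t t) k" if "t \<ge> 0" for t
    using rotating_pendulum_elliptic_coordinates[of \<gamma> c \<phi> k t] ode(1,2) that assms(1,2)
    by (simp_all add: init assms(3,4,5))
  define A B where "A t = jacobi_dn (\<psi>\<^sub>t t) k - k * jacobi_cn (\<psi>\<^sub>t t) k"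
    and "B t = jacobi_dn (\<psi>\<^sub>t t) k + k * jacobi_cn (\<psi>\<^sub>t t) k" for t
  have AB: "A t * B t = 1 - k\<^sup>2" and A_pos: "A t > 0" for t
    unfolding A_def B_def by (rule jacobi_dn_cn_product[OF k] jacobi_dn_minus_cn_pos[OF k])+
  have w: "w = 1 / A 0" by (simp add: A_def \<psi>\<^sub>t assms(7))
  then have w_pos: "w > 0" using A_pos by simp
  have \<psi>\<^sub>t_deriv: "(\<psi>\<^sub>t has_real_derivative 1 / k) (at t within {0..})" for t
    unfolding \<psi>\<^sub>t using k_pos by (auto intro!: derivative_eq_intros)

  have z: "z t = s\<^sub>2 * ln (A t * w)" if "t \<ge> 0" for t
  proof -
    have "z t = s\<^sub>2 * (ln (A t) + ln w)"
    proof (rule equal_if_equal_derivatives_nonneg[where D = "\<lambda>t. sin (\<gamma> t / 2)", OF _ _ _ that])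
      fix t :: real
      assume t: "t \<ge> 0"
      show "(z has_real_derivative sin (\<gamma> t / 2)) (at t within {0..})"
        by (rule ode(5)[OF t])
      have "((\<lambda>t. s\<^sub>2 * (ln (A t) + ln w)) has_real_derivative
          s\<^sub>2 * (k * jacobi_sn (\<psi>\<^sub>t t) k * (1 / k) + 0)) (at t within {0..})"
        unfolding A_def
        by (intro DERIV_cmult DERIV_add DERIV_const
            DERIV_chain2[OF ln_jacobi_dn_minus_cn_has_real_derivative[OF k] \<psi>\<^sub>t_deriv])
      then show "((\<lambda>t. s\<^sub>2 * (ln (A t) + ln w)) has_real_derivative sin (\<gamma> t / 2)) (at t within {0..})"
        using k_pos by (simp add: sin_\<gamma>[OF t])
    next
      show "z 0 = s\<^sub>2 * (ln (A 0) + ln w)"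
        using A_pos[of 0] by (simp add: init w ln_div)
    qed
    then show ?thesis using A_pos[of t] w_pos by (simp add: ln_mult)
  qed

  (* v is the coefficient of dn + k cn in exp (- s2 z), as w is that of dn - k cn in exp (s2 z) *)
  define v where "v = 1 / (w * (1 - k\<^sup>2))"
  have inverse: "inverse (A t * w) = v * B t" for t
  proof -
    have "B t \<noteq> 0" using AB[of t] k by auto
    then show ?thesis
      unfolding v_def AB[of t, symmetric] using A_pos[of t] w_pos by (simp add: field_simps)
  qed
  have AwB: "cosh (ln (A t * w)) = (A t * w + v * B t) / 2"
    "sinh (ln (A t * w)) = (A t * w - v * B t) / 2" for t
    using A_pos[of t] w_pos by (simp_all only: cosh_ln_real sinh_ln_real inverse mult_pos_pos)
  have cosh_z: "cosh (z t) = (A t * w + v * B t) / 2"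
    and sinh_z: "sinh (z t) = s\<^sub>2 * ((A t * w - v * B t) / 2)" if "t \<ge> 0" for t
    using s by (elim disjE; simp add: z[OF that] AwB del: minus_diff_eq)+

  define I J where
    "I t = jacobi_E (\<psi>\<^sub>t t) k - jacobi_E \<psi> k - k'\<^sup>2 * (\<psi>\<^sub>t t - \<psi>)"
    and "J t = k * (jacobi_sn (\<psi>\<^sub>t t) k - jacobi_sn \<psi> k)" for t
  have IJ0: "I 0 = 0" "J 0 = 0" by (simp_all add: I_def J_def \<psi>\<^sub>t)
  have I: "(I has_real_derivative k * (jacobi_cn (\<psi>\<^sub>t t) k)\<^sup>2) (at t within {0..})"
    and J: "(J has_real_derivative jacobi_cn (\<psi>\<^sub>t t) k * jacobi_dn (\<psi>\<^sub>t t) k) (at t within {0..})" for t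
    unfolding I_def J_def \<psi>\<^sub>t assms(6)
    by (rule primitive_k_cn_squared[OF k] primitive_cn_dn[OF k], use k_pos in simp)+
  (* J + I and J - I are the primitives of cn (dn + k cn) and cn (dn - k cn) *)
  have x: "x t = 1/2 * (v * (J t + I t) + w * (J t - I t))" if "t \<ge> 0" for t
  proof (rule equal_if_equal_derivatives_nonneg[OF ode(3) _ _ that])
    fix t :: real
    assume t: "t \<ge> 0"
    show "((\<lambda>t. 1/2 * (v * (J t + I t) + w * (J t - I t))) has_real_derivative
        cos (\<gamma> t / 2) * cosh (z t)) (at t within {0..})"
      unfolding cos_\<gamma>[OF t] cosh_z[OF t]
      by (rule derivative_eq_intros I J refl)+
         (simp add: A_def B_def algebra_simps power2_eq_square add_divide_distrib)
  qed (simp_all add: init IJ0)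
  have y: "y t = s\<^sub>2/2 * (w * (J t - I t) - v * (J t + I t))" if "t \<ge> 0" for t
  proof (rule equal_if_equal_derivatives_nonneg[OF ode(4) _ _ that])
    fix t :: real
    assume t: "t \<ge> 0"
    show "((\<lambda>t. s\<^sub>2/2 * (w * (J t - I t) - v * (J t + I t))) has_real_derivative
        cos (\<gamma> t / 2) * sinh (z t)) (at t within {0..})"
      unfolding cos_\<gamma>[OF t] sinh_z[OF t]
      by (rule derivative_eq_intros I J refl)+
         (simp add: A_def B_def algebra_simps power2_eq_square add_divide_distrib diff_divide_distrib)
  qed (simp_all add: init IJ0)

  have kv: "k / (w * (1 - k\<^sup>2)) = k * v" by (simp add: v_def)
  show ?thesis
    unfolding kv v_def[symmetric] I_def[symmetric] A_def[symmetric]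
    by (auto simp: x y z J_def field_simps)
qed

end
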